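(* Let $(P_n,\beta)$ be the edge-labeled path graph with vertices $v_1,\dots,v_n$ (in this order along the path), module $m_j\mathbb{Z}$ at $v_j$ and module $\mathbb{Z}/r_k\mathbb{Z}$ at the edge $v_kv_{k+1}$, where $m_1,\dots,m_n$ and $r_1,\dots,r_{n-1}$ are arbitrary integers. Then there exists a flow-up class $F^{(i)}=(0,\dots,0,f^{(i)}_{v_i},\dots,f^{(i)}_{v_n})$ on $(P_n,\beta)$ with first nonzero entry $$[m_i,r_{i-1},(m_{i+1},r_i),(m_{i+2},r_i,r_{i+1}),\dots,(m_n,r_i,r_{i+1},\dots,r_{n-1})]$$ for $i=1,2,\dots,n$. For $i=1$, we set $r_0=1$.
   Context: Notation: $(\ )$ denotes the greatest common divisor and $[\ ]$ the least common multiple of integers. A spline on $(P_n,\beta)$ is a tuple $(f_{v_1},\dots,f_{v_n})$ of integers with $f_{v_j}\in m_j\mathbb{Z}$ for all $j$ and $f_{v_k}\equiv f_{v_{k+1}}\pmod{r_k}$ for $k=1,\dots,n-1$. An $i$-th flow-up class is a spline $F^{(i)}$ with $f^{(i)}_{v_i}\neq0$ and $f^{(i)}_{v_s}=0$ for all $s<i$.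
   Formalization: The claim is proved for each i for which the displayed least common multiple is nonzero; with arbitrary integer labels it can be 0 (e.g. m_i = 0), and then no flow-up class can have it as its nonzero i-th entry. *)

theory Defs
  imports "HOL-Number_Theory.Cong"
begin

text \<open>
  The edge-labeled path on v_1, ..., v_n is given by its number n of vertices, the vertex labels
  m 1, ..., m n and the edge labels r 1, ..., r (n - 1), where r k labels the edge v_k v_(k+1).
  A tuple (f_1, ..., f_n) is a function on the natural numbers whose values outside {1..n} are
  irrelevant.
\<close>

definition path_spline :: "nat \<Rightarrow> (nat \<Rightarrow> int) \<Rightarrow> (nat \<Rightarrow> int) \<Rightarrow> (nat \<Rightarrow> int) \<Rightarrow> bool" where
  "path_spline n m r f \<longleftrightarrow>
     (\<forall>j\<in>{1..n}. m j dvd f j) \<and> (\<forall>k\<in>{1..<n}. [f k = f (Suc k)] (mod r k))"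

definition flow_up_class ::
    "nat \<Rightarrow> (nat \<Rightarrow> int) \<Rightarrow> (nat \<Rightarrow> int) \<Rightarrow> nat \<Rightarrow> (nat \<Rightarrow> int) \<Rightarrow> bool" where
  "flow_up_class n m r i f \<longleftrightarrow>
     path_spline n m r f \<and> f i \<noteq> 0 \<and> (\<forall>s\<in>{1..<i}. f s = 0)"

text \<open>
  The least common multiple of m_i, r_(i-1) (read as 1 if i = 1) and the numbers
  gcd (m_j, r_i, ..., r_(j-1)) for i < j \<le> n.
\<close>

definition leading_entry :: "nat \<Rightarrow> (nat \<Rightarrow> int) \<Rightarrow> (nat \<Rightarrow> int) \<Rightarrow> nat \<Rightarrow> int" where
  "leading_entry n m r i =
     Lcm ({m i, if i = 1 then 1 else r (i - 1)} \<union>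
          (\<lambda>j. Gcd (insert (m j) (r ` {i..<j}))) ` {i<..n})"

text \<open>
  The labels may be 0. The leading entry then vanishes exactly when one of the numbers whose
  least common multiple is taken is 0. It is nonzero in particular if all labels are.
\<close>

lemma leading_entry_eq_0_iff:
  "leading_entry n m r i = 0 \<longleftrightarrow>
     m i = 0 \<or> (i \<noteq> 1 \<and> r (i - 1) = 0) \<or>
     (\<exists>j\<in>{i<..n}. m j = 0 \<and> (\<forall>k\<in>{i..<j}. r k = 0))"
  unfolding leading_entry_def
  by (subst Lcm_0_iff) (auto simp: image_iff)

lemma leading_entry_nonzero:
  assumes "\<And>j. j \<in> {1..n} \<Longrightarrow> m j \<noteq> 0" and "\<And>k. k \<in> {1..<n} \<Longrightarrow> r k \<noteq> 0" and "i \<in> {1..n}"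
  shows "leading_entry n m r i \<noteq> 0"
proof -
  have "r (i - 1) \<noteq> 0" if "i \<noteq> 1"
    using assms(3) that by (intro assms(2)) auto
  moreover have "m j \<noteq> 0" if "j \<in> {i..n}" for j
    using assms(3) that by (intro assms(1)) auto
  ultimately show ?thesis
    using assms(3) by (auto simp: leading_entry_eq_0_iff)
qed

end

theory Submission imports Defs begin

text \<open>
  A value x at v_i extends to a spline on v_i, ..., v_n as soon as every gcd (m_j, r_i, ..., r_(j-1))
  divides x. Going one step along the path, one needs some y with y congruent to x modulo r_i that is
  divisible by all gcd (m_j, r_(i+1), ..., r_(j-1)), that is, by their least common multiple L. Such
  a y exists if and only if gcd (r_i, L) divides x, and gcd (r_i, L) is the least common multiple of
  the original gcds because gcd distributes over lcm.
\<close>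

lemma gcd_Lcm_dvd_int:
  fixes r x :: int
  assumes "finite A" and "\<And>a. a \<in> A \<Longrightarrow> gcd r a dvd x"
  shows "gcd r (Lcm A) dvd x"
  using assms
proof (induction A)
  case (insert a A)
  have "gcd r (lcm a (Lcm A)) = lcm (gcd r a) (gcd r (Lcm A))"
    by (rule gcd_lcm_distrib)
  with insert show ?case by simp
qed simp

text \<open>The common multiples of \<open>A\<close> are the numbers \<open>Lcm A * c\<close>, so
  this is one linear congruence in \<open>c\<close>, solvable once \<open>gcd (Lcm A) r\<close>
  divides \<open>x\<close>.\<close>

lemma ex_multiple_cong_int:
  fixes r x :: int
  assumes "finite A" and "\<And>a. a \<in> A \<Longrightarrow> gcd r a dvd x"
  shows "\<exists>y. [x = y] (mod r) \<and> (\<forall>a\<in>A. a dvd y)"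
proof -
  from assms have "gcd (Lcm A) r dvd x"
    by (subst gcd.commute) (rule gcd_Lcm_dvd_int)
  then obtain c where "[Lcm A * c = x] (mod r)"
    using cong_solve_dvd_int by blast
  then have "[x = Lcm A * c] (mod r)"
    by (rule cong_sym)
  then show ?thesis
    by (intro exI[of _ "Lcm A * c"]) simp
qed

text \<open>Downward induction on \<open>i\<close> from \<open>n\<close>; \<open>x\<close> stays
  arbitrary because the next vertex gets a new value \<open>y\<close>.\<close>

lemma path_spline_extend:
  fixes m r :: "nat \<Rightarrow> int"
  assumes "i \<le> n" and "\<And>j. j \<in> {i..n} \<Longrightarrow> Gcd (insert (m j) (r ` {i..<j})) dvd x"
  shows "\<exists>f. f i = x \<and> (\<forall>j\<in>{i..n}. m j dvd f j) \<and>
           (\<forall>k\<in>{i..<n}. [f k = f (Suc k)] (mod r k))"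
  using assms
proof (induction arbitrary: x rule: inc_induct)
  case base
  then show ?case by (intro exI[of _ "\<lambda>_. x"]) simp
next
  case (step i)
  let ?g = "\<lambda>j. Gcd (insert (m j) (r ` {Suc i..<j}))"
  have "gcd (r i) (?g j) dvd x" if "j \<in> {Suc i..n}" for j
  proof -
    \<comment> \<open>Splitting off the edge label \<open>r i\<close> turns the hypothesis on
      \<open>x\<close> into the solvability condition for \<open>y\<close>.\<close>
    have "{i..<j} = insert i {Suc i..<j}" using that by auto
    then have "gcd (r i) (?g j) = Gcd (insert (m j) (r ` {i..<j}))"
      by (simp add: insert_commute flip: Gcd_insert)
    with step.prems[of j] that show ?thesis by simp
  qed
  then have "\<exists>y. [x = y] (mod r i) \<and> (\<forall>a\<in>?g ` {Suc i..n}. a dvd y)"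
    by (intro ex_multiple_cong_int) blast+
  then obtain y where y: "[x = y] (mod r i)" "\<And>j. j \<in> {Suc i..n} \<Longrightarrow> ?g j dvd y"
    by blast
  from step.IH[OF y(2)] obtain f where f: "f (Suc i) = y" "\<forall>j\<in>{Suc i..n}. m j dvd f j"
    "\<forall>k\<in>{Suc i..<n}. [f k = f (Suc k)] (mod r k)" by blast
  \<comment> \<open>For \<open>j = i\<close> the edge range is empty and the \<open>Gcd\<close> is
    \<open>m i\<close> up to sign.\<close>
  have "m i dvd x" using step.prems[of i] step.hyps by simp
  with f y(1) show ?case
    by (intro exI[of _ "f(i := x)"]) (auto simp: Suc_le_eq)
qed

text \<open>Zero labels can make the formula vanish, whereas a flow-up class is nonzero at
  \<open>i\<close>; hence the premise.\<close>

theorem theorem5p3: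
  fixes n :: nat and m r :: "nat \<Rightarrow> int"
  shows "\<forall>i\<in>{1..n}. leading_entry n m r i \<noteq> 0 \<longrightarrow>
           (\<exists>F. flow_up_class n m r i F \<and> F i = leading_entry n m r i)"
proof (intro ballI impI)
  fix i
  assume i: "i \<in> {1..n}" and nz: "leading_entry n m r i \<noteq> 0"
  let ?x = "leading_entry n m r i"
  have edge: "r (i - 1) dvd ?x" if "i \<noteq> 1"
    unfolding leading_entry_def using that by (intro dvd_Lcm) simp
  have "Gcd (insert (m j) (r ` {i..<j})) dvd ?x" if "j \<in> {i..n}" for j
  proof (cases "j = i")
    case True
    have "m i dvd ?x" unfolding leading_entry_def by (intro dvd_Lcm) simp
    with True show ?thesis by simp
  next
    case False
    with that show ?thesis unfolding leading_entry_def by (intro dvd_Lcm) auto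
  qed
  with i have "\<exists>f. f i = ?x \<and> (\<forall>j\<in>{i..n}. m j dvd f j) \<and>
      (\<forall>k\<in>{i..<n}. [f k = f (Suc k)] (mod r k))"
    by (intro path_spline_extend) auto
  then obtain f where f: "f i = ?x" "\<And>j. j \<in> {i..n} \<Longrightarrow> m j dvd f j"
    "\<And>k. k \<in> {i..<n} \<Longrightarrow> [f k = f (Suc k)] (mod r k)"
    by blast
  \<comment> \<open>The values of \<open>f\<close> before \<open>i\<close> are uncontrolled, so they
    are replaced by zeros.\<close>
  define F where "F j = (if j < i then 0 else f j)" for j
  have "[F k = F (Suc k)] (mod r k)" if k: "k \<in> {1..<n}" for k
  proof -
    consider "Suc k < i" | "Suc k = i" | "i \<le> k" by linarith
    then show ?thesis
    proof cases
      \<comment> \<open>Only this edge joins the zeros to the leading entry;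
        \<open>r (i - 1)\<close> enters the lcm for its sake.\<close>
      case 2
      then have "i - 1 = k" "i \<noteq> 1" using k by auto
      with edge have "[?x = 0] (mod r k)" by (simp add: cong_0_iff)
      moreover have "F k = 0" "F (Suc k) = ?x" unfolding F_def 2 using 2 f(1) by auto
      ultimately show ?thesis by (metis cong_sym)
    qed (use f(3) k in \<open>auto simp: F_def\<close>)
  qed
  moreover have "m j dvd F j" if "j \<in> {1..n}" for j
    using f(2) that by (simp add: F_def)
  ultimately have "flow_up_class n m r i F"
    using f(1) nz by (simp add: flow_up_class_def path_spline_def F_def)
  moreover have "F i = ?x" using f(1) by (simp add: F_def)
  ultimately show "\<exists>F. flow_up_class n m r i F \<and> F i = ?x" by blast
qed

end
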